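(* Let $0<r\le1\le R<\infty$ with $r<R$, let $I\subset\mathbb{R}_+$ be an interval containing $[r,R]$, and let $f_1,f_2:I\to\mathbb{R}$ be differentiable convex functions with $f_1(1)=f_2(1)=0$. Suppose that $f_1$ and $f_2$ are twice differentiable on $(r,R)$, that $f_2''(x)>0$ for all $x\in(r,R)$, and that there exist real constants $\alpha<\beta$ such that $$\alpha\le\frac{f_1''(x)}{f_2''(x)}\le\beta\qquad\text{for all }x\in(r,R).$$ Let $n\ge2$ and let $P=(p_1,\dots,p_n),\,Q=(q_1,\dots,q_n)\in\Gamma_n$ satisfy $r\le \frac{p_i}{q_i}\le R$ for all $i=1,\dots,n$. Then $$\alpha\,C_{f_2}(P\|Q)\le C_{f_1}(P\|Q)\le\beta\,C_{f_2}(P\|Q),$$ $$\alpha\left[E_{f_2}(P\|Q)-C_{f_2}(P\|Q)\right]\le E_{f_1}(P\|Q)-C_{f_1}(P\|Q)\le\beta\left[E_{f_2}(P\|Q)-C_{f_2}(P\|Q)\right],$$ $$\alpha\left[A_{f_2}(r,R)-C_{f_2}(P\|Q)\right]\le A_{f_1}(r,R)-C_{f_1}(P\|Q)\le\beta\left[A_{f_2}(r,R)-C_{f_2}(P\|Q)\right],$$ and $$\alpha\left[B_{f_2}(r,R)-C_{f_2}(P\|Q)\right]\le B_{f_1}(r,R)-C_{f_1}(P\|Q)\le\beta\left[B_{f_2}(r,R)-C_{f_2}(P\|Q)\right].$$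
   Context: $\Gamma_n=\{(p_1,\dots,p_n): p_i>0,\ \sum_{i=1}^n p_i=1\}$, $n\ge2$. For a differentiable convex function $f$ with $f(1)=0$ (derivatives at endpoints of its interval of definition, if any, being one-sided), define $$C_f(P\|Q)=\sum_{i=1}^n q_i f\Big(\frac{p_i}{q_i}\Big)\quad\text{(Csisz\'ar's $f$-divergence)},\qquad E_f(P\|Q)=\sum_{i=1}^n(p_i-q_i)f'\Big(\frac{p_i}{q_i}\Big),$$ $$A_f(r,R)=\tfrac14(R-r)\left(f'(R)-f'(r)\right),\qquad B_f(r,R)=\frac{(R-1)f(r)+(1-r)f(R)}{R-r}.$$ *)

theory Defs
  imports "HOL-Analysis.Analysis"
begin

(* Derivative relative to the domain S of f: on an interval S it is the two-sided derivative
   at interior points and the one-sided derivative at those endpoints that belong to S. *)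
definition deriv_within :: "(real \<Rightarrow> real) \<Rightarrow> real set \<Rightarrow> real \<Rightarrow> real" where
  "deriv_within f S x = vector_derivative f (at x within S)"

definition pos_prob_vecs :: "(real ^ 'n) set" ("\<Gamma>") where
  "\<Gamma> = {p. (\<forall>i. p $ i > 0) \<and> (\<Sum>i\<in>UNIV. p $ i) = 1}"

definition C_div :: "(real \<Rightarrow> real) \<Rightarrow> real ^ 'n \<Rightarrow> real ^ 'n \<Rightarrow> real" where
  "C_div f P Q = (\<Sum>i\<in>UNIV. Q $ i * f (P $ i / Q $ i))"

(* In E_div and A_div the set I is the interval of definition of f. *)
definition E_div :: "real set \<Rightarrow> (real \<Rightarrow> real) \<Rightarrow> real ^ 'n \<Rightarrow> real ^ 'n \<Rightarrow> real" where
  "E_div I f P Q = (\<Sum>i\<in>UNIV. (P $ i - Q $ i) * deriv_within f I (P $ i / Q $ i))"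

definition A_div :: "real set \<Rightarrow> (real \<Rightarrow> real) \<Rightarrow> real \<Rightarrow> real \<Rightarrow> real" where
  "A_div I f r R = 1 / 4 * (R - r) * (deriv_within f I R - deriv_within f I r)"

definition B_div :: "(real \<Rightarrow> real) \<Rightarrow> real \<Rightarrow> real \<Rightarrow> real" where
  "B_div f r R = ((R - 1) * f r + (1 - r) * f R) / (R - r)"

end

theory Submission
  imports Defs
begin

text \<open>
  Both \<open>h = f1 - \<alpha> f2\<close> and \<open>h = \<beta> f2 - f1\<close> are convex on \<open>[r, R]\<close> and vanish at 1, and all four
  functionals are linear in the generator, so each inequality amounts to
  \<open>0 \<le> C h \<le> E h\<close> and \<open>C h \<le> B h \<le> A h\<close>.
  These follow from the fact that the graph of \<open>h\<close> lies above its tangents: at 1, the tangent integrates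
  to 0; the tangents at \<open>p i / q i\<close>, evaluated at 1, give the bound by \<open>E\<close>; the chord over \<open>[r, R]\<close>
  integrates to \<open>B\<close>; and the tangents at \<open>r\<close> and \<open>R\<close>, evaluated at 1, give
  \<open>B \<le> (R - 1) (1 - r) (h' R - h' r) / (R - r) \<le> A\<close>.
\<close>

text \<open>The condition \<open>0 \<le> g'\<close> makes \<open>g\<close> nondecreasing on the open
  interval. The mean value theorem turns the slope between \<open>x\<close> and \<open>y\<close>
  into some \<open>g \<xi>\<close>. This \<open>\<xi>\<close> is interior even when \<open>y\<close>
  is an endpoint, so it can be compared with \<open>g x\<close>.\<close>

lemma above_tangent_interior:
  fixes h g g' :: "real \<Rightarrow> real"
  assumes h: "\<And>x. x \<in> {r..R} \<Longrightarrow> (h has_real_derivative g x) (at x within {r..R})"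
    and g: "\<And>x. x \<in> {r<..<R} \<Longrightarrow> (g has_real_derivative g' x) (at x)"
    and g': "\<And>x. x \<in> {r<..<R} \<Longrightarrow> 0 \<le> g' x"
    and x: "x \<in> {r<..<R}" and y: "y \<in> {r..R}"
  shows "h x + g x * (y - x) \<le> h y"
proof -
  have mono: "g u \<le> g v" if "u \<in> {r<..<R}" "v \<in> {r<..<R}" "u \<le> v" for u v
    using that by (intro DERIV_nonneg_imp_nondecreasing[of u v g]) (auto intro!: exI g g')
  have mvt: "\<exists>\<xi>>u. \<xi> < v \<and> h v - h u = (v - u) * g \<xi>" if "r \<le> u" "u < v" "v \<le> R" for u v
  proof -
    have "(h has_derivative (*) (g z)) (at z within {u..v})" if "u \<le> z" "z \<le> v" for z
      using h[of z] that \<open>r \<le> u\<close> \<open>v \<le> R\<close>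
      by (auto simp: has_field_derivative_def intro: has_derivative_subset)
    from mvt_simple[OF \<open>u < v\<close> this] show ?thesis
      by (auto simp: mult.commute)
  qed
  consider "x < y" | "y = x" | "y < x" by linarith
  then show ?thesis
  proof cases
    case 1
    then obtain \<xi> where \<xi>: "x < \<xi>" "\<xi> < y" "h y - h x = (y - x) * g \<xi>"
      using mvt[of x y] x y by auto
    have "(y - x) * g x \<le> (y - x) * g \<xi>"
      using mono[of x \<xi>] \<xi> x y by (intro mult_left_mono) auto
    then show ?thesis using \<xi> by (simp add: algebra_simps)
  next
    case 2
    then show ?thesis by simp
  next
    case 3
    then obtain \<xi> where \<xi>: "y < \<xi>" "\<xi> < x" "h x - h y = (x - y) * g \<xi>"
      using mvt[of y x] x y by auto
    have "(x - y) * g \<xi> \<le> (x - y) * g x"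
      using mono[of \<xi> x] \<xi> x y by (intro mult_left_mono) auto
    then show ?thesis using \<xi> by (simp add: algebra_simps)
  qed
qed

text \<open>Since \<open>g\<close> is not assumed continuous at the endpoints, tangents there are obtained as limits of
  secants of the convex function \<open>h\<close>.\<close>

lemma above_tangent:
  fixes h g g' :: "real \<Rightarrow> real"
  assumes h: "\<And>x. x \<in> {r..R} \<Longrightarrow> (h has_real_derivative g x) (at x within {r..R})"
    and g: "\<And>x. x \<in> {r<..<R} \<Longrightarrow> (g has_real_derivative g' x) (at x)"
    and g': "\<And>x. x \<in> {r<..<R} \<Longrightarrow> 0 \<le> g' x"
    and x: "x \<in> {r..R}" and y: "y \<in> {r..R}"
  shows "h x + g x * (y - x) \<le> h y"
proof (cases "x = y")
  case False
  define \<phi> where "\<phi> t = x + t * (y - x)" for t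
  have \<phi>_conv: "\<phi> t = (1 - t) * x + t * y" for t
    by (simp add: \<phi>_def algebra_simps)
  have \<phi>_mem: "\<phi> t \<in> {r..R}" if "t \<in> {0..1}" for t
    using convexD[of "{r..R}" x y "1 - t" t] that x y by (simp add: \<phi>_conv)
  have \<phi>_int: "\<phi> t \<in> {r<..<R}" if "t \<in> {0<..<1}" for t
  proof -
    have "\<phi> t \<in> open_segment x y"
      using that False unfolding in_segment
      by (auto simp: \<phi>_conv intro!: exI[of _ t])
    then show ?thesis using x y by (auto simp: open_segment_eq_real_ivl split: if_splits)
  qed
  have secant: "(h (\<phi> t) - h x) / t \<le> h y - h x" if t: "t \<in> {0<..<1}" for t
  proof -
    let ?z = "\<phi> t"
    \<comment> \<open>The tangent at the interior point \<open>?z\<close> is evaluated at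
      \<open>x\<close> and at \<open>y\<close>. As \<open>?z\<close> is the mean of \<open>x\<close>
      and \<open>y\<close> with weights \<open>1 - t\<close> and \<open>t\<close>, the slope terms
      cancel.\<close>
    have "(1 - t) * (h ?z + g ?z * (x - ?z)) + t * (h ?z + g ?z * (y - ?z)) \<le> (1 - t) * h x + t * h y"
      using above_tangent_interior[OF h g g' \<phi>_int[OF t] x]
        above_tangent_interior[OF h g g' \<phi>_int[OF t] y] t
      by (intro add_mono mult_left_mono) auto
    also have "(1 - t) * (h ?z + g ?z * (x - ?z)) + t * (h ?z + g ?z * (y - ?z)) = h ?z"
      by (simp add: \<phi>_def algebra_simps)
    finally show ?thesis using t by (simp add: field_simps)
  qed
  \<comment> \<open>The one-sided derivative at 0 along the segment is the limit of the secant
    slopes bounded above.\<close>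
  have "((h \<circ> \<phi>) has_real_derivative g x * (y - x)) (at 0 within {0..1})"
  proof (rule DERIV_image_chain)
    have "(h has_real_derivative g x) (at x within \<phi> ` {0..1})"
      using h[OF x] by (rule DERIV_subset) (use \<phi>_mem in auto)
    then show "(h has_real_derivative g x) (at (\<phi> 0) within \<phi> ` {0..1})"
      by (simp add: \<phi>_def)
    show "(\<phi> has_real_derivative y - x) (at 0 within {0..1})"
      unfolding \<phi>_def by (auto intro!: derivative_eq_intros)
  qed
  then have lim: "((\<lambda>t. (h (\<phi> t) - h x) / t) \<longlongrightarrow> g x * (y - x)) (at_right 0)"
    by (simp add: has_field_derivative_iff \<phi>_def at_within_Icc_at_right)
  have "eventually (\<lambda>t. (h (\<phi> t) - h x) / t \<le> h y - h x) (at_right 0)"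
    using eventually_at_right_real[OF zero_less_one] by eventually_elim (rule secant)
  from tendsto_upperbound[OF lim this] show ?thesis by simp
qed simp

text \<open>The ratios have \<open>Q\<close>-weighted mean 1, so averaging an affine function over
  them gives its value at 1. This turns pointwise affine bounds on \<open>h\<close> into bounds on
  \<open>C_div\<close>.\<close>

lemma \<Gamma>_ratio_sums:
  fixes P Q :: "real ^ 'n"
  assumes "P \<in> \<Gamma>" "Q \<in> \<Gamma>"
  shows "Q $ i > 0" and "(\<Sum>i\<in>UNIV. Q $ i * (a + b * (P $ i / Q $ i))) = a + b"
proof -
  have pos: "Q $ i > 0" for i using assms by (simp add: pos_prob_vecs_def)
  have "Q $ i * (a + b * (P $ i / Q $ i)) = a * Q $ i + b * P $ i" for i
    using pos[of i] by (simp add: field_simps)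
  then show "(\<Sum>i\<in>UNIV. Q $ i * (a + b * (P $ i / Q $ i))) = a + b"
    using assms by (simp add: pos_prob_vecs_def sum.distrib flip: sum_distrib_left)
  show "Q $ i > 0" by (rule pos)
qed

text \<open>The bounds are phrased with a slope function \<open>g\<close> instead of
  \<open>deriv_within\<close>, so that for a combination of \<open>f1\<close> and \<open>f2\<close>
  the same combination of their derivatives can be inserted directly.\<close>

locale above_tangents =
  fixes r R :: real and h g :: "real \<Rightarrow> real" and P Q :: "real ^ 'n"
  assumes r: "r \<le> 1" and R: "1 \<le> R" and rR: "r < R"
    and tangent: "\<And>x y. x \<in> {r..R} \<Longrightarrow> y \<in> {r..R} \<Longrightarrow> h x + g x * (y - x) \<le> h y"
    and h1: "h 1 = 0"
    and P: "P \<in> \<Gamma>" and Q: "Q \<in> \<Gamma>"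
    and ratio: "\<And>i. P $ i / Q $ i \<in> {r..R}"
begin

lemma C_div_nonneg: "0 \<le> C_div h P Q"
proof -
  have "(\<Sum>i\<in>UNIV. Q $ i * (- g 1 + g 1 * (P $ i / Q $ i))) \<le> C_div h P Q"
    unfolding C_div_def
  proof (intro sum_mono mult_left_mono)
    show "- g 1 + g 1 * (P $ i / Q $ i) \<le> h (P $ i / Q $ i)" for i
      using tangent[of 1 "P $ i / Q $ i"] ratio[of i] r R h1
      by (simp add: right_diff_distrib)
  qed (use \<Gamma>_ratio_sums(1)[OF P Q] in \<open>auto intro: less_imp_le\<close>)
  then show ?thesis by (simp only: \<Gamma>_ratio_sums(2)[OF P Q])
qed

lemma C_div_le_E: "C_div h P Q \<le> (\<Sum>i\<in>UNIV. (P $ i - Q $ i) * g (P $ i / Q $ i))"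
  unfolding C_div_def
proof (rule sum_mono)
  fix i
  let ?x = "P $ i / Q $ i"
  have q: "Q $ i > 0" using \<Gamma>_ratio_sums(1)[OF P Q] .
  have "Q $ i * h ?x \<le> Q $ i * (g ?x * (?x - 1))"
    using tangent[of ?x 1] ratio[of i] r R h1 q
    by (intro mult_left_mono) (auto simp: right_diff_distrib)
  also have "\<dots> = (P $ i - Q $ i) * g ?x"
    using q by (simp add: field_simps)
  finally show "Q $ i * h ?x \<le> (P $ i - Q $ i) * g ?x" .
qed

lemma C_div_le_B: "C_div h P Q \<le> B_div h r R"
proof -
  \<comment> \<open>Intercept and slope of the chord through \<open>(r, h r)\<close> and
    \<open>(R, h R)\<close>; its value at 1 is \<open>B_div h r R\<close>.\<close>
  let ?a = "(R * h r - r * h R) / (R - r)" and ?b = "(h R - h r) / (R - r)"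
  have chord: "h x \<le> ?a + ?b * x" if x: "x \<in> {r..R}" for x
  proof -
    \<comment> \<open>The weights \<open>R - x\<close> and \<open>x - r\<close> make the slope terms
      of the tangent at \<open>x\<close> cancel.\<close>
    have "(R - x) * (h x + g x * (r - x)) + (x - r) * (h x + g x * (R - x))
        \<le> (R - x) * h r + (x - r) * h R"
      using tangent[OF x, of r] tangent[OF x, of R] x rR
      by (intro add_mono mult_left_mono) auto
    then have "(R - r) * h x \<le> (R - x) * h r + (x - r) * h R"
      by (simp add: algebra_simps)
    also have "\<dots> = (R * h r - r * h R) + (h R - h r) * x"
      by (simp add: algebra_simps)
    also have "\<dots> = (R - r) * ?a + ((R - r) * ?b) * x"
      using rR by simp
    also have "\<dots> = (R - r) * (?a + ?b * x)"
      by (simp only: distrib_left mult.assoc)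
    finally show ?thesis using rR by simp
  qed
  have "C_div h P Q \<le> (\<Sum>i\<in>UNIV. Q $ i * (?a + ?b * (P $ i / Q $ i)))"
    unfolding C_div_def
    by (intro sum_mono mult_left_mono chord ratio less_imp_le \<Gamma>_ratio_sums(1)[OF P Q])
  also have "\<dots> = B_div h r R"
    unfolding \<Gamma>_ratio_sums(2)[OF P Q] B_div_def
    by (simp add: algebra_simps flip: add_divide_distrib)
  finally show ?thesis .
qed

lemma B_div_le_A: "B_div h r R \<le> 1 / 4 * (R - r) * (g R - g r)"
proof -
  have "h r \<le> g r * (r - 1)" and "h R \<le> g R * (R - 1)"
    using tangent[of r 1] tangent[of R 1] r R rR h1 by (auto simp: algebra_simps)
  then have "(R - 1) * h r + (1 - r) * h R \<le> (R - 1) * (g r * (r - 1)) + (1 - r) * (g R * (R - 1))"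
    using r R by (intro add_mono mult_left_mono) auto
  also have "\<dots> = (R - 1) * (1 - r) * (g R - g r)"
    by (simp add: algebra_simps)
  also have "\<dots> \<le> (R - r)\<^sup>2 / 4 * (g R - g r)"
  proof (rule mult_right_mono)
    \<comment> \<open>Arithmetic-geometric mean inequality for \<open>R - 1\<close> and
      \<open>1 - r\<close>, whose sum is \<open>R - r\<close>; this is where the factor 1/4 in
      \<open>A_div\<close> comes from.\<close>
    have "0 \<le> ((R - 1) - (1 - r))\<^sup>2" by simp
    then show "(R - 1) * (1 - r) \<le> (R - r)\<^sup>2 / 4"
      by (simp add: power2_eq_square algebra_simps)
    \<comment> \<open>Add the tangent at \<open>r\<close> evaluated at \<open>R\<close> to the
      tangent at \<open>R\<close> evaluated at \<open>r\<close>.\<close>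
    have "(R - r) * g r \<le> (R - r) * g R"
      using tangent[of r R] tangent[of R r] rR by (simp add: algebra_simps)
    then show "0 \<le> g R - g r" using rR by simp
  qed
  finally show ?thesis
    using rR by (simp add: B_div_def divide_le_eq power2_eq_square mult_ac)
qed

end

theorem proposition3:
  fixes r R \<alpha> \<beta> :: real and I :: "real set" and f1 f2 :: "real \<Rightarrow> real"
    and P Q :: "real ^ 'n"
  assumes "0 < r" "r \<le> 1" "1 \<le> R" "r < R"
    and "is_interval I" "I \<subseteq> {0..}" "{r..R} \<subseteq> I"
    and "f1 differentiable_on I" "convex_on I f1" "f1 1 = 0"
    and "f2 differentiable_on I" "convex_on I f2" "f2 1 = 0"
    and "deriv_within f1 I differentiable_on {r<..<R}"
    and "deriv_within f2 I differentiable_on {r<..<R}"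
    and "\<forall>x\<in>{r<..<R}. deriv (deriv_within f2 I) x > 0"
    and "\<alpha> < \<beta>"
    and "\<forall>x\<in>{r<..<R}. \<alpha> \<le> deriv (deriv_within f1 I) x / deriv (deriv_within f2 I) x
           \<and> deriv (deriv_within f1 I) x / deriv (deriv_within f2 I) x \<le> \<beta>"
    and "CARD('n) \<ge> 2"
    and "P \<in> \<Gamma>" "Q \<in> \<Gamma>"
    and "\<forall>i. r \<le> P $ i / Q $ i \<and> P $ i / Q $ i \<le> R"
  shows "(\<alpha> * C_div f2 P Q \<le> C_div f1 P Q \<and> C_div f1 P Q \<le> \<beta> * C_div f2 P Q)
    \<and> (\<alpha> * (E_div I f2 P Q - C_div f2 P Q) \<le> E_div I f1 P Q - C_div f1 P Q
       \<and> E_div I f1 P Q - C_div f1 P Q \<le> \<beta> * (E_div I f2 P Q - C_div f2 P Q))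
    \<and> (\<alpha> * (A_div I f2 r R - C_div f2 P Q) \<le> A_div I f1 r R - C_div f1 P Q
       \<and> A_div I f1 r R - C_div f1 P Q \<le> \<beta> * (A_div I f2 r R - C_div f2 P Q))
    \<and> (\<alpha> * (B_div f2 r R - C_div f2 P Q) \<le> B_div f1 r R - C_div f1 P Q
       \<and> B_div f1 r R - C_div f1 P Q \<le> \<beta> * (B_div f2 r R - C_div f2 P Q))"
proof -
  let ?g1 = "deriv_within f1 I" and ?g2 = "deriv_within f2 I"
  \<comment> \<open>If \<open>r\<close> or \<open>R\<close> is interior to \<open>I\<close>, the
    derivative there is two-sided; restricting the limit to \<open>{r..R}\<close> keeps its
    value.\<close>
  have within: "(f has_real_derivative deriv_within f I x) (at x within {r..R})"
    if "f differentiable_on I" "x \<in> {r..R}" for f x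
  proof -
    have "(f has_vector_derivative deriv_within f I x) (at x within I)"
      using that \<open>{r..R} \<subseteq> I\<close> unfolding deriv_within_def differentiable_on_def
      by (auto simp flip: vector_derivative_works)
    then have "(f has_real_derivative deriv_within f I x) (at x within I)"
      by (simp add: has_real_derivative_iff_has_vector_derivative)
    then show ?thesis using \<open>{r..R} \<subseteq> I\<close> by (rule DERIV_subset)
  qed
  have deriv: "(g has_real_derivative deriv g x) (at x)"
    if "g differentiable_on {r<..<R}" "x \<in> {r<..<R}" for g :: "real \<Rightarrow> real" and x
    using that
    by (metis DERIV_deriv_iff_real_differentiable differentiable_on_eq_differentiable_at
        open_greaterThanLessThan)
  have comb: "above_tangents r R (\<lambda>x. a * f1 x + b * f2 x) (\<lambda>x. a * ?g1 x + b * ?g2 x) P Q"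
    if nonneg: "\<And>x. x \<in> {r<..<R} \<Longrightarrow> 0 \<le> a * deriv ?g1 x + b * deriv ?g2 x" for a b
  proof
    fix x y assume "x \<in> {r..R}" "y \<in> {r..R}"
    then show "a * f1 x + b * f2 x + (a * ?g1 x + b * ?g2 x) * (y - x) \<le> a * f1 y + b * f2 y"
      by (rule above_tangent[rotated -2, where g' = "\<lambda>x. a * deriv ?g1 x + b * deriv ?g2 x"])
        (use assms nonneg in \<open>auto intro!: DERIV_add DERIV_cmult within deriv\<close>)
  qed (use assms in auto)
  \<comment> \<open>Arbitrary coefficients let one statement serve both sides of every inequality.
    The bound by \<open>A_div\<close> passes through \<open>B_div\<close>.\<close>
  have bounds: "0 \<le> a * C_div f1 P Q + b * C_div f2 P Q
      \<and> a * C_div f1 P Q + b * C_div f2 P Q \<le> a * E_div I f1 P Q + b * E_div I f2 P Q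
      \<and> a * C_div f1 P Q + b * C_div f2 P Q \<le> a * A_div I f1 r R + b * A_div I f2 r R
      \<and> a * C_div f1 P Q + b * C_div f2 P Q \<le> a * B_div f1 r R + b * B_div f2 r R"
    if nonneg: "\<And>x. x \<in> {r<..<R} \<Longrightarrow> 0 \<le> a * deriv ?g1 x + b * deriv ?g2 x" for a b
  proof -
    interpret above_tangents r R "\<lambda>x. a * f1 x + b * f2 x" "\<lambda>x. a * ?g1 x + b * ?g2 x" P Q
      using nonneg by (rule comb)
    have C: "C_div (\<lambda>x. a * f1 x + b * f2 x) P Q = a * C_div f1 P Q + b * C_div f2 P Q"
      by (simp add: C_div_def sum_distrib_left sum.distrib algebra_simps)
    have E: "(\<Sum>i\<in>UNIV. (P $ i - Q $ i) * (a * ?g1 (P $ i / Q $ i) + b * ?g2 (P $ i / Q $ i)))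
        = a * E_div I f1 P Q + b * E_div I f2 P Q"
      unfolding E_div_def sum_distrib_left sum.distrib[symmetric]
      by (intro sum.cong) (auto simp: algebra_simps)
    have A: "1 / 4 * (R - r) * (a * ?g1 R + b * ?g2 R - (a * ?g1 r + b * ?g2 r))
        = a * A_div I f1 r R + b * A_div I f2 r R"
      by (simp add: A_div_def field_simps)
    have B: "B_div (\<lambda>x. a * f1 x + b * f2 x) r R = a * B_div f1 r R + b * B_div f2 r R"
      unfolding B_div_def times_divide_eq_right add_divide_distrib[symmetric]
      by (simp add: algebra_simps)
    show ?thesis
      using C_div_nonneg C_div_le_E C_div_le_B B_div_le_A unfolding C E A B by linarith
  qed
  \<comment> \<open>The quotient bounds are multiplied by the positive second derivative of
    \<open>f2\<close>.\<close>
  have ratio: "0 \<le> deriv ?g1 x - \<alpha> * deriv ?g2 x" "0 \<le> \<beta> * deriv ?g2 x - deriv ?g1 x"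
    if "x \<in> {r<..<R}" for x
    using assms(16,18) that by (auto simp: pos_le_divide_eq pos_divide_le_eq)
  show ?thesis
    \<comment> \<open>The first instance, \<open>f1 - \<alpha> f2\<close>, yields all lower bounds;
      the second, \<open>\<beta> f2 - f1\<close>, all upper bounds.\<close>
    using bounds[of 1 "- \<alpha>"] bounds[of "-1" \<beta>] ratio by (simp add: right_diff_distrib)
qed

end
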